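(* Let $\Theta=\{\theta_1<\dots<\theta_K\}\subset\mathbb{R}_+$, fix $\mu\in\Delta(\Theta)$ with full support, and let $\sigma,\sigma'\in\Sigma^\star(\mu)$. The following two claims are equivalent: (i) $\sigma\succsim_{\mathcal{R}}\sigma'$, i.e. for every $w\in\mathcal{R}$, $\sum_{(\theta,p)\in\Theta\times P}w(\theta,p)\sigma(\theta,p)\ge\sum_{(\theta,p)\in\Theta\times P}w(\theta,p)\sigma'(\theta,p)$; (ii) there exist $n\in\mathbb{N}$, $n>0$, and $(t_1,\dots,t_n)\in\mathcal{T}^n$ such that $\sigma=\sigma'+\sum_{i=1}^n t_i$.
   Context: Setting. $\Theta=\{\theta_1<\dots<\theta_K\}\subset\mathbb{R}_+$ is a finite set (buyer types) and $P=\Theta$ (prices). $\Delta(X)$ is the set of probability distributions on a finite set $X$. The market $\mu\in\Delta(\Theta)$ satisfies $\mu(\theta)>0$ for all $\theta\in\Theta$. Segmentations. $\Sigma(\mu)$ is the set of $\sigma\in\Delta(\Theta\times P)$ such that $\sum_{p\in P}\sigma(\theta,p)=\mu(\theta)$ for all $\theta\in\Theta$ and (obedience) for all $p,q\in P$, $p\sum_{\theta\ge p}\sigma(\theta,p)\ge q\sum_{\theta\ge q}\sigma(\theta,p)$. Let $\Omega=\{(\theta,p)\in\Theta\times P:\theta\ge p\}$ and $\Sigma^\star(\mu)=\{\sigma\in\Sigma(\mu):\operatorname{supp}(\sigma)\subseteq\Omega\}$; elements of $\Sigma^\star(\mu)$ are identified with elements of $\mathbb{R}^\Omega$ by restriction.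 Redistributive welfare functions. $\mathcal{R}$ is the set of $w:\Theta\times P\to\mathbb{R}$ such that: $w(\theta,p)=0$ if $\theta<p$ and $w(\theta,p)\ge0$ if $\theta\ge p$; for each $k$, $p\mapsto w(\theta_k,p)$ is non-increasing on $\{\theta_1,\dots,\theta_k\}$; and for all $\theta,\theta'\in\Theta$ and $p,p'\in P$ with $\theta'>\theta\ge p'>p$, $w(\theta,p)-w(\theta,p')\ge w(\theta',p)-w(\theta',p')$. Transfers. A transfer is a map $t:\Omega\to\mathbb{R}$ with $\sum_{p\le\theta}t(\theta,p)=0$ for all $\theta\in\Theta$. It is downward if there exist $\delta\ge0$ and $\tilde\theta,p',p''\in\Theta$ with $p'<p''\le\tilde\theta$ such that $t(\tilde\theta,p')=\delta$, $t(\tilde\theta,p'')=-\delta$, and $t=0$ elsewhere. It is redistributive if there exist $\varepsilon\ge0$ and $(\theta',p''),(\theta'',p')\in\Omega$ with $\theta'<\theta''$, $p'<p''$ such that $t=\varepsilon$ at $(\theta',p')$ and $(\theta'',p'')$, $t=-\varepsilon$ at $(\theta',p'')$ and $(\theta'',p')$, and $t=0$ elsewhere. $\mathcal{T}$ is the set of all downward and all redistributive transfers.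
   Formalization: The type set is assumed to have at least two elements (K ≥ 2); for K = 1 there are no transfers at all, so (ii) fails for every n > 0 while (i) holds trivially with σ = σ'. *)

theory Defs
  imports "HOL-Probability.Probability_Mass_Function"
begin

definition dists :: "'a set \<Rightarrow> 'a pmf set" where
  "dists X = {\<mu>. set_pmf \<mu> \<subseteq> X}"

text \<open>
  Throughout, \<open>\<Theta>\<close> is the finite set of buyer types and also the set of prices;
  pairs are written (type, price).
\<close>

definition obedient :: "real set \<Rightarrow> (real \<times> real) pmf \<Rightarrow> bool" where
  "obedient \<Theta> \<sigma> \<longleftrightarrow> (\<forall>p\<in>\<Theta>. \<forall>q\<in>\<Theta>.
     p * (\<Sum>\<theta>\<in>{\<theta>\<in>\<Theta>. \<theta> \<ge> p}. pmf \<sigma> (\<theta>, p)) \<ge> q * (\<Sum>\<theta>\<in>{\<theta>\<in>\<Theta>. \<theta> \<ge> q}. pmf \<sigma> (\<theta>, p)))"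

definition segmentations :: "real set \<Rightarrow> real pmf \<Rightarrow> (real \<times> real) pmf set" where
  "segmentations \<Theta> \<mu> = {\<sigma> \<in> dists (\<Theta> \<times> \<Theta>).
     (\<forall>\<theta>\<in>\<Theta>. (\<Sum>p\<in>\<Theta>. pmf \<sigma> (\<theta>, p)) = pmf \<mu> \<theta>) \<and> obedient \<Theta> \<sigma>}"

definition \<Omega> :: "real set \<Rightarrow> (real \<times> real) set" where
  "\<Omega> \<Theta> = {(\<theta>, p) \<in> \<Theta> \<times> \<Theta>. \<theta> \<ge> p}"

definition segmentations_star :: "real set \<Rightarrow> real pmf \<Rightarrow> (real \<times> real) pmf set" where
  "segmentations_star \<Theta> \<mu> = {\<sigma> \<in> segmentations \<Theta> \<mu>. set_pmf \<sigma> \<subseteq> \<Omega> \<Theta>}"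

text \<open>
  Functions on \<open>\<Theta> \<times> \<Theta>\<close> and on \<open>\<Omega> \<Theta>\<close> are represented by total functions
  whose values outside these sets are irrelevant.
\<close>

definition redistributive_welfare :: "real set \<Rightarrow> (real \<times> real \<Rightarrow> real) set" where
  "redistributive_welfare \<Theta> = {w.
     (\<forall>\<theta>\<in>\<Theta>. \<forall>p\<in>\<Theta>. (\<theta> < p \<longrightarrow> w (\<theta>, p) = 0) \<and> (\<theta> \<ge> p \<longrightarrow> w (\<theta>, p) \<ge> 0)) \<and>
     (\<forall>\<theta>\<in>\<Theta>. antimono_on {p\<in>\<Theta>. p \<le> \<theta>} (\<lambda>p. w (\<theta>, p))) \<and>
     (\<forall>\<theta>\<in>\<Theta>. \<forall>\<theta>'\<in>\<Theta>. \<forall>p\<in>\<Theta>. \<forall>p'\<in>\<Theta>. \<theta>' > \<theta> \<and> \<theta> \<ge> p' \<and> p' > p \<longrightarrow>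
        w (\<theta>, p) - w (\<theta>, p') \<ge> w (\<theta>', p) - w (\<theta>', p'))}"

definition redistributively_preferred ::
    "real set \<Rightarrow> (real \<times> real) pmf \<Rightarrow> (real \<times> real) pmf \<Rightarrow> bool" where
  "redistributively_preferred \<Theta> \<sigma> \<sigma>' \<longleftrightarrow> (\<forall>w\<in>redistributive_welfare \<Theta>.
     (\<Sum>x\<in>\<Theta> \<times> \<Theta>. w x * pmf \<sigma> x) \<ge> (\<Sum>x\<in>\<Theta> \<times> \<Theta>. w x * pmf \<sigma>' x))"

definition is_transfer :: "real set \<Rightarrow> (real \<times> real \<Rightarrow> real) \<Rightarrow> bool" where
  "is_transfer \<Theta> t \<longleftrightarrow> (\<forall>\<theta>\<in>\<Theta>. (\<Sum>p\<in>{p\<in>\<Theta>. p \<le> \<theta>}. t (\<theta>, p)) = 0)"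

definition downward :: "real set \<Rightarrow> (real \<times> real \<Rightarrow> real) \<Rightarrow> bool" where
  "downward \<Theta> t \<longleftrightarrow> (\<exists>\<delta>\<ge>0. \<exists>\<theta>\<in>\<Theta>. \<exists>p'\<in>\<Theta>. \<exists>p''\<in>\<Theta>. p' < p'' \<and> p'' \<le> \<theta> \<and>
     t (\<theta>, p') = \<delta> \<and> t (\<theta>, p'') = - \<delta> \<and>
     (\<forall>x\<in>\<Omega> \<Theta> - {(\<theta>, p'), (\<theta>, p'')}. t x = 0))"

definition redistributive :: "real set \<Rightarrow> (real \<times> real \<Rightarrow> real) \<Rightarrow> bool" where
  "redistributive \<Theta> t \<longleftrightarrow> (\<exists>\<epsilon>\<ge>0. \<exists>\<theta>' p'' \<theta>'' p'.
     (\<theta>', p'') \<in> \<Omega> \<Theta> \<and> (\<theta>'', p') \<in> \<Omega> \<Theta> \<and> \<theta>' < \<theta>'' \<and> p' < p'' \<and>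
     t (\<theta>', p') = \<epsilon> \<and> t (\<theta>'', p'') = \<epsilon> \<and> t (\<theta>', p'') = - \<epsilon> \<and> t (\<theta>'', p') = - \<epsilon> \<and>
     (\<forall>x\<in>\<Omega> \<Theta> - {(\<theta>', p'), (\<theta>'', p''), (\<theta>', p''), (\<theta>'', p')}. t x = 0))"

text \<open>The set of admissible transfers is empty if \<open>\<Theta>\<close> is a singleton.\<close>

definition transfers :: "real set \<Rightarrow> (real \<times> real \<Rightarrow> real) set" where
  "transfers \<Theta> = {t. is_transfer \<Theta> t \<and> (downward \<Theta> t \<or> redistributive \<Theta> t)}"

end

theory Submission
  imports Defs
begin

text \<open>
  Every \<open>w \<in> redistributive_welfare \<Theta>\<close> pairs nonnegatively with every transfer, which gives one
  direction. For the other, put \<open>d = \<sigma> - \<sigma>'\<close>. The functions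
  \<open>w(\<theta>, q) = [q \<le> p < \<theta> \<le> \<theta>\<^sub>0]\<close> lie in \<open>redistributive_welfare \<Theta>\<close>, so the double partial sums
  \<open>S(\<theta>\<^sub>0, p)\<close> of \<open>d\<close> over \<open>q \<le> p < \<theta> \<le> \<theta>\<^sub>0\<close> are nonnegative. Summation by parts in both variables
  (using that \<open>d\<close> has zero row sums) writes \<open>d\<close> as the sum over all \<open>(\<theta>\<^sub>0, p)\<close> of \<open>S(\<theta>\<^sub>0, p)\<close> times a
  unit transfer between the neighbouring prices \<open>p < p\<^sup>+\<close>: redistributive between the types
  \<open>\<theta>\<^sub>0\<close> and \<open>\<theta>\<^sub>0\<^sup>+\<close>, or downward if \<open>\<theta>\<^sub>0\<close> is the highest type.
\<close>

section \<open>Neighbours in a finite chain, and summation by parts\<close>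

definition covers :: "'a::linorder set \<Rightarrow> 'a \<Rightarrow> 'a \<Rightarrow> bool" where
  "covers A x y \<longleftrightarrow> x \<in> A \<and> y \<in> A \<and> x < y \<and> (\<forall>z\<in>A. z \<le> x \<or> y \<le> z)"

lemma covers_unique_upper: "covers A x y \<Longrightarrow> covers A x z \<longleftrightarrow> z = y"
  unfolding covers_def by (metis less_le_not_le order_antisym)

lemma covers_unique_lower: "covers A x y \<Longrightarrow> covers A z y \<longleftrightarrow> z = x"
  unfolding covers_def by (metis less_le_not_le order_antisym)

lemma ex_covers_upper:
  assumes "finite A" "x \<in> A" "z \<in> A" "x < z"
  obtains y where "covers A x y" "y \<le> z"
proof
  let ?B = "{y \<in> A. x < y}"
  have B: "finite ?B" "z \<in> ?B" using assms by auto
  then have "Min ?B \<in> ?B" by (intro Min_in) auto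
  moreover have "z' \<le> x \<or> Min ?B \<le> z'" if "z' \<in> A" for z'
    using that B(1) by (cases "x < z'") auto
  ultimately show "covers A x (Min ?B)"
    using assms(2) unfolding covers_def by blast
  show "Min ?B \<le> z" using B by simp
qed

lemma ex_covers_lower:
  assumes "finite A" "x \<in> A" "z \<in> A" "z < x"
  obtains y where "covers A y x"
proof
  let ?B = "{y \<in> A. y < x}"
  have B: "finite ?B" "z \<in> ?B" using assms by auto
  then have "Max ?B \<in> ?B" by (intro Max_in) auto
  moreover have "z' \<le> Max ?B \<or> x \<le> z'" if "z' \<in> A" for z'
    using that B(1) by (cases "z' < x") auto
  ultimately show "covers A (Max ?B) x"
    using assms(2) unfolding covers_def by blast
qed

text \<open>The bracket inverts the operator of partial sums: only \<open>y = x\<close> and the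
  predecessor of \<open>x\<close> contribute, and the difference of their partial sums is
  \<open>f x\<close>. At the least element the \<open>covers\<close> term vanishes, so no boundary
  value has to be chosen.\<close>

lemma sum_partial_sums_covers:
  fixes f :: "'a::linorder \<Rightarrow> 'b::comm_ring_1"
  assumes A: "finite A" "x \<in> A"
  shows "(\<Sum>y\<in>A. (\<Sum>z\<in>{z\<in>A. z \<le> y}. f z) * (of_bool (x = y) - of_bool (covers A y x))) = f x"
proof -
  let ?F = "\<lambda>y. \<Sum>z\<in>{z\<in>A. z \<le> y}. f z"
  have split: "(\<Sum>y\<in>A. ?F y * (of_bool (x = y) - of_bool (covers A y x)))
      = ?F x - (\<Sum>y\<in>A. ?F y * of_bool (covers A y x))"
    using A by (simp add: right_diff_distrib sum_subtractf)
  show ?thesis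
  proof (cases "\<exists>y. covers A y x")
    case True
    then obtain y where y: "covers A y x" by blast
    then have yA: "y \<in> A" and Ax: "{z\<in>A. z \<le> x} = insert x {z\<in>A. z \<le> y}"
      unfolding covers_def by (auto dest: order_antisym)
    have "(\<Sum>y\<in>A. ?F y * of_bool (covers A y x)) = ?F y"
      using A yA by (simp add: covers_unique_lower[OF y] of_bool_def if_distrib cong: if_cong)
    moreover have "?F x = f x + ?F y"
      unfolding Ax using A y by (subst sum.insert) (auto simp: covers_def)
    ultimately show ?thesis using split by simp
  next
    case False
    then have "{z\<in>A. z \<le> x} = {x}"
      using ex_covers_lower[OF A] A(2) by (auto simp: le_less)
    with False split show ?thesis by simp
  qed
qed

section \<open>Unit transfers between neighbouring types and prices\<close>

text \<open>In each coordinate this is the bracket of \<open>sum_partial_sums_covers\<close>; hence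
  the product form. If \<open>\<theta>\<^sub>0\<close> is the highest type, the first
  \<open>covers\<close> term vanishes and only the row of \<open>\<theta>\<^sub>0\<close>
  remains.\<close>

definition unit_transfer :: "real set \<Rightarrow> real \<Rightarrow> real \<Rightarrow> real \<times> real \<Rightarrow> real" where
  "unit_transfer \<Theta> \<theta>\<^sub>0 p = (\<lambda>(\<theta>, q).
     (of_bool (\<theta> = \<theta>\<^sub>0) - of_bool (covers \<Theta> \<theta>\<^sub>0 \<theta>)) * (of_bool (q = p) - of_bool (covers \<Theta> p q)))"

text \<open>Since \<open>p < \<theta>\<^sub>0\<close>, the next price is at most
  \<open>\<theta>\<^sub>0\<close>, so every cell that the transfer touches lies in
  \<open>\<Omega> \<Theta>\<close>.\<close>

lemma scaled_unit_transfer_in_transfers: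
  assumes "finite \<Theta>" "\<theta>\<^sub>0 \<in> \<Theta>" "p \<in> \<Theta>" "p < \<theta>\<^sub>0" "c \<ge> 0"
  shows "(\<lambda>x. c * unit_transfer \<Theta> \<theta>\<^sub>0 p x) \<in> transfers \<Theta>"
proof -
  obtain p' where p': "covers \<Theta> p p'" "p' \<le> \<theta>\<^sub>0"
    using ex_covers_upper[of \<Theta> p \<theta>\<^sub>0] assms by blast
  note cp = covers_unique_upper[OF p'(1)]
  have pp: "p' \<in> \<Theta>" "p < p'" using p' by (auto simp: covers_def)
  let ?t = "\<lambda>x. c * unit_transfer \<Theta> \<theta>\<^sub>0 p x"
  have "(\<Sum>q\<in>{q\<in>\<Theta>. q \<le> \<theta>}. ?t (\<theta>, q)) = 0" if "\<theta> \<in> \<Theta>" for \<theta>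
  \<comment> \<open>From \<open>\<theta>\<^sub>0\<close> upwards a row contains both prices, whose
    entries cancel; below \<open>\<theta>\<^sub>0\<close> the type factor is zero.\<close>
  proof (cases "\<theta>\<^sub>0 \<le> \<theta>")
    case True
    then have "p \<le> \<theta>" "p' \<le> \<theta>" using assms p' by auto
    then have "(\<Sum>q\<in>{q\<in>\<Theta>. q \<le> \<theta>}. of_bool (q = p) - of_bool (q = p') :: real) = 0"
      using assms pp by (simp add: sum_subtractf of_bool_def)
    then show ?thesis
      by (simp add: unit_transfer_def cp sum_distrib_left[symmetric])
  next
    case False
    then show ?thesis by (auto simp: unit_transfer_def covers_def)
  qed
  then have "is_transfer \<Theta> ?t" by (simp add: is_transfer_def)
  moreover have "downward \<Theta> ?t \<or> redistributive \<Theta> ?t"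
  proof (cases "\<exists>\<theta>\<^sub>1. covers \<Theta> \<theta>\<^sub>0 \<theta>\<^sub>1")
    case True
    then obtain \<theta>\<^sub>1 where th: "covers \<Theta> \<theta>\<^sub>0 \<theta>\<^sub>1" by blast
    note ct = covers_unique_upper[OF th]
    have t1: "\<theta>\<^sub>1 \<in> \<Theta>" "\<theta>\<^sub>0 < \<theta>\<^sub>1" using th by (auto simp: covers_def)
    \<comment> \<open>The higher price, called \<open>p''\<close> in the definition, is the local
      \<open>p'\<close>; the lower one is \<open>p\<close>.\<close>
    have "redistributive \<Theta> ?t"
      unfolding redistributive_def
      by (rule exI[of _ c], rule conjI[OF assms(5)], rule exI[of _ \<theta>\<^sub>0], rule exI[of _ p'],
          rule exI[of _ \<theta>\<^sub>1], rule exI[of _ p])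
        (use assms pp p'(2) t1 in \<open>auto simp: unit_transfer_def \<Omega>_def cp ct\<close>)
    then show ?thesis ..
  next
    case False
    then have "downward \<Theta> ?t"
      unfolding downward_def
      by - (rule exI[of _ c], rule conjI[OF assms(5)], rule bexI[of _ \<theta>\<^sub>0], rule bexI[of _ p],
          rule bexI[of _ p'], use assms pp p'(2) in \<open>auto simp: unit_transfer_def cp\<close>)
    then show ?thesis ..
  qed
  ultimately show ?thesis by (simp add: transfers_def)
qed

text \<open>Serves as padding in the decomposition. Even the zero transfer needs two distinct prices
  to count as downward.\<close>

lemma zero_in_transfers:
  assumes "card \<Theta> \<ge> 2"
  shows "(\<lambda>x. 0) \<in> transfers \<Theta>"
proof -
  obtain a b where "a \<in> \<Theta>" "b \<in> \<Theta>" "a \<noteq> b"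
    using assms by (auto simp: numeral_2_eq_2 card_le_Suc_iff)
  then obtain a b where "a \<in> \<Theta>" "b \<in> \<Theta>" "a < b" by (metis linorder_neqE)
  then have "downward \<Theta> (\<lambda>x. 0)" unfolding downward_def by force
  then show ?thesis by (simp add: transfers_def is_transfer_def)
qed

section \<open>Welfare functions against transfers\<close>

text \<open>A downward transfer picks out one decrease of \<open>w\<close> in the price, a
  redistributive one the difference of two such decreases at two types; the conditions on
  \<open>w\<close> give the sign of each.\<close>

lemma sum_welfare_transfer_nonneg:
  assumes fin: "finite \<Theta>" and w: "w \<in> redistributive_welfare \<Theta>" and t: "t \<in> transfers \<Theta>"
  shows "(\<Sum>x\<in>\<Omega> \<Theta>. w x * t x) \<ge> 0"
proof -
  have fo: "finite (\<Omega> \<Theta>)"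
    using fin by (intro finite_subset[of "\<Omega> \<Theta>" "\<Theta> \<times> \<Theta>"]) (auto simp: \<Omega>_def)
  from t consider "downward \<Theta> t" | "redistributive \<Theta> t" by (auto simp: transfers_def)
  then show ?thesis
  proof cases
    case 1
    then obtain \<delta> \<theta> p' p'' where d: "\<delta> \<ge> 0" "\<theta> \<in> \<Theta>" "p' \<in> \<Theta>" "p'' \<in> \<Theta>" "p' < p''" "p'' \<le> \<theta>"
      "t (\<theta>, p') = \<delta>" "t (\<theta>, p'') = - \<delta>" "\<forall>x\<in>\<Omega> \<Theta> - {(\<theta>, p'), (\<theta>, p'')}. t x = 0"
      unfolding downward_def by blast
    have "(\<Sum>x\<in>\<Omega> \<Theta>. w x * t x) = (\<Sum>x\<in>{(\<theta>, p'), (\<theta>, p'')}. w x * t x)"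
      using d fo by (intro sum.mono_neutral_right) (auto simp: \<Omega>_def)
    also have "\<dots> = \<delta> * (w (\<theta>, p') - w (\<theta>, p''))"
      using d by (simp add: algebra_simps)
    also have "\<dots> \<ge> 0"
    proof -
      have "antimono_on {p\<in>\<Theta>. p \<le> \<theta>} (\<lambda>p. w (\<theta>, p))"
        using w d by (simp add: redistributive_welfare_def)
      then have "w (\<theta>, p'') \<le> w (\<theta>, p')"
        using d by (auto elim!: monotone_onD)
      then show ?thesis using d by simp
    qed
    finally show ?thesis .
  next
    case 2
    then obtain \<epsilon> \<theta>' p'' \<theta>'' p' where e: "\<epsilon> \<ge> 0" "(\<theta>', p'') \<in> \<Omega> \<Theta>" "(\<theta>'', p') \<in> \<Omega> \<Theta>"
      "\<theta>' < \<theta>''" "p' < p''" "t (\<theta>', p') = \<epsilon>" "t (\<theta>'', p'') = \<epsilon>" "t (\<theta>', p'') = - \<epsilon>"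
      "t (\<theta>'', p') = - \<epsilon>"
      "\<forall>x\<in>\<Omega> \<Theta> - {(\<theta>', p'), (\<theta>'', p''), (\<theta>', p''), (\<theta>'', p')}. t x = 0"
      unfolding redistributive_def by blast
    have "(\<Sum>x\<in>\<Omega> \<Theta>. w x * t x)
        = (\<Sum>x\<in>{(\<theta>', p'), (\<theta>'', p''), (\<theta>', p''), (\<theta>'', p')}. w x * t x)"
      using e fo by (intro sum.mono_neutral_right) (auto simp: \<Omega>_def)
    also have "\<dots> = \<epsilon> * ((w (\<theta>', p') - w (\<theta>', p'')) - (w (\<theta>'', p') - w (\<theta>'', p'')))"
      using e by (simp add: algebra_simps)
    also have "\<dots> \<ge> 0"
    proof -
      have "w (\<theta>', p') - w (\<theta>', p'') \<ge> w (\<theta>'', p') - w (\<theta>'', p'')"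
        using w e unfolding redistributive_welfare_def \<Omega>_def by blast
      then show ?thesis using e by simp
    qed
    finally show ?thesis .
  qed
qed

lemma sum_welfare_restrict:
  assumes "finite \<Theta>" "w \<in> redistributive_welfare \<Theta>"
  shows "(\<Sum>x\<in>\<Theta> \<times> \<Theta>. w x * f x) = (\<Sum>x\<in>\<Omega> \<Theta>. w x * f x)"
proof (rule sum.mono_neutral_right)
  show "\<forall>x\<in>\<Theta> \<times> \<Theta> - \<Omega> \<Theta>. w x * f x = 0"
    using assms(2) by (fastforce simp: \<Omega>_def redistributive_welfare_def)
qed (use assms(1) in \<open>auto simp: \<Omega>_def\<close>)

lemma transfers_imp_preferred:
  assumes fin: "finite \<Theta>" and t: "\<And>i. i \<in> I \<Longrightarrow> t i \<in> transfers \<Theta>"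
    and eq: "\<And>x. x \<in> \<Omega> \<Theta> \<Longrightarrow> pmf \<sigma> x = pmf \<sigma>' x + (\<Sum>i\<in>I. t i x)"
  shows "redistributively_preferred \<Theta> \<sigma> \<sigma>'"
  unfolding redistributively_preferred_def
proof
  fix w assume w: "w \<in> redistributive_welfare \<Theta>"
  have "(\<Sum>x\<in>\<Omega> \<Theta>. w x * pmf \<sigma> x)
      = (\<Sum>x\<in>\<Omega> \<Theta>. w x * pmf \<sigma>' x) + (\<Sum>x\<in>\<Omega> \<Theta>. \<Sum>i\<in>I. w x * t i x)"
    by (simp add: eq distrib_left sum.distrib sum_distrib_left)
  also have "(\<Sum>x\<in>\<Omega> \<Theta>. \<Sum>i\<in>I. w x * t i x) = (\<Sum>i\<in>I. \<Sum>x\<in>\<Omega> \<Theta>. w x * t i x)"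
    by (rule sum.swap)
  finally have "(\<Sum>x\<in>\<Omega> \<Theta>. w x * pmf \<sigma> x)
      = (\<Sum>x\<in>\<Omega> \<Theta>. w x * pmf \<sigma>' x) + (\<Sum>i\<in>I. \<Sum>x\<in>\<Omega> \<Theta>. w x * t i x)" .
  moreover have "(\<Sum>i\<in>I. \<Sum>x\<in>\<Omega> \<Theta>. w x * t i x) \<ge> 0"
    by (intro sum_nonneg sum_welfare_transfer_nonneg fin w t)
  ultimately show "(\<Sum>x\<in>\<Theta> \<times> \<Theta>. w x * pmf \<sigma>' x) \<le> (\<Sum>x\<in>\<Theta> \<times> \<Theta>. w x * pmf \<sigma> x)"
    by (simp add: sum_welfare_restrict[OF fin w])
qed

section \<open>Threshold functions and the decomposition of a difference\<close>

definition threshold_welfare :: "real \<Rightarrow> real \<Rightarrow> real \<times> real \<Rightarrow> real" where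
  "threshold_welfare \<theta>\<^sub>0 p = (\<lambda>(\<theta>, q). of_bool (q \<le> p \<and> p < \<theta> \<and> \<theta> \<le> \<theta>\<^sub>0))"

text \<open>For \<open>\<theta> \<ge> p2 > p1\<close>, the function drops between \<open>p1\<close>
  and \<open>p2\<close> exactly if \<open>p1 \<le> p < p2\<close> and
  \<open>\<theta> \<le> \<theta>\<^sub>0\<close>, as \<open>p < \<theta>\<close> is then automatic.
  So a drop at a higher type forces the same drop at a lower one.\<close>

lemma threshold_welfare_redistributive: "threshold_welfare \<theta>\<^sub>0 p \<in> redistributive_welfare \<Theta>"
  by (auto simp: threshold_welfare_def redistributive_welfare_def monotone_on_def)

text \<open>Brings the pairing into the shape of an iterated partial sum, ready for
  \<open>sum_partial_sums_covers\<close>; the cut \<open>p < \<theta>\<close> stays behind as a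
  factor.\<close>

lemma sum_threshold_welfare:
  assumes "finite \<Theta>"
  shows "(\<Sum>x\<in>\<Theta> \<times> \<Theta>. threshold_welfare \<theta>\<^sub>0 p x * d x)
    = (\<Sum>\<theta>\<in>{\<theta>\<in>\<Theta>. \<theta> \<le> \<theta>\<^sub>0}. of_bool (p < \<theta>) * (\<Sum>q\<in>{q\<in>\<Theta>. q \<le> p}. d (\<theta>, q)))"
proof -
  have "(\<Sum>x\<in>\<Theta> \<times> \<Theta>. threshold_welfare \<theta>\<^sub>0 p x * d x)
      = (\<Sum>\<theta>\<in>\<Theta>. \<Sum>q\<in>\<Theta>. threshold_welfare \<theta>\<^sub>0 p (\<theta>, q) * d (\<theta>, q))"
    by (simp add: sum.cartesian_product)
  also have "\<dots> = (\<Sum>\<theta>\<in>\<Theta>. if \<theta> \<le> \<theta>\<^sub>0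
      then of_bool (p < \<theta>) * (\<Sum>q\<in>\<Theta>. if q \<le> p then d (\<theta>, q) else 0) else 0)"
    by (rule sum.cong) (auto simp: threshold_welfare_def sum_distrib_left intro!: sum.cong)
  finally show ?thesis using assms by (simp only: sum.inter_filter)
qed

text \<open>Two inversions of partial sums: the sum over \<open>\<theta>\<^sub>0\<close> undoes the
  one over types, then the sum over \<open>p\<close> undoes the one over prices.\<close>

lemma sum_unit_transfers:
  fixes d :: "real \<times> real \<Rightarrow> real"
  assumes fin: "finite \<Theta>" and \<theta>: "\<theta> \<in> \<Theta>" and q: "q \<in> \<Theta>"
    and row: "(\<Sum>p\<in>\<Theta>. d (\<theta>, p)) = 0"
    and supp: "\<And>p. p \<in> \<Theta> \<Longrightarrow> \<theta> < p \<Longrightarrow> d (\<theta>, p) = 0"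
  shows "(\<Sum>(\<theta>\<^sub>0, p)\<in>\<Theta> \<times> \<Theta>.
    (\<Sum>x\<in>\<Theta> \<times> \<Theta>. threshold_welfare \<theta>\<^sub>0 p x * d x) * unit_transfer \<Theta> \<theta>\<^sub>0 p (\<theta>, q)) = d (\<theta>, q)"
proof -
  let ?D = "\<lambda>\<theta> p. \<Sum>q\<in>{q\<in>\<Theta>. q \<le> p}. d (\<theta>, q)"
  let ?S = "\<lambda>\<theta>\<^sub>0 p. \<Sum>\<theta>\<in>{\<theta>\<in>\<Theta>. \<theta> \<le> \<theta>\<^sub>0}. of_bool (p < \<theta>) * ?D \<theta> p"
  let ?a = "\<lambda>y x. of_bool (x = y) - of_bool (covers \<Theta> y x) :: real"
  \<comment> \<open>The cut costs nothing: for \<open>p \<ge> \<theta>\<close> the partial sum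
    already exhausts the support of the row, so it equals the row total, zero.\<close>
  have D: "of_bool (p < \<theta>) * ?D \<theta> p = ?D \<theta> p" if "p \<in> \<Theta>" for p
  proof (cases "p < \<theta>")
    case False
    then have "?D \<theta> p = (\<Sum>q\<in>\<Theta>. d (\<theta>, q))"
      using fin by (intro sum.mono_neutral_left) (auto intro!: supp)
    with row show ?thesis by simp
  qed simp
  have "(\<Sum>(\<theta>\<^sub>0, p)\<in>\<Theta> \<times> \<Theta>.
      (\<Sum>x\<in>\<Theta> \<times> \<Theta>. threshold_welfare \<theta>\<^sub>0 p x * d x) * unit_transfer \<Theta> \<theta>\<^sub>0 p (\<theta>, q))
    = (\<Sum>\<theta>\<^sub>0\<in>\<Theta>. \<Sum>p\<in>\<Theta>. ?S \<theta>\<^sub>0 p * (?a \<theta>\<^sub>0 \<theta> * ?a p q))"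
    by (simp only: sum_threshold_welfare[OF fin] unit_transfer_def sum.cartesian_product prod.case)
  also have "\<dots> = (\<Sum>p\<in>\<Theta>. (\<Sum>\<theta>\<^sub>0\<in>\<Theta>. ?S \<theta>\<^sub>0 p * ?a \<theta>\<^sub>0 \<theta>) * ?a p q)"
    by (subst sum.swap) (simp only: sum_distrib_right mult.assoc)
  also have "\<dots> = (\<Sum>p\<in>\<Theta>. ?D \<theta> p * ?a p q)"
    by (intro sum.cong refl) (simp only: sum_partial_sums_covers[OF fin \<theta>] D)
  also have "\<dots> = d (\<theta>, q)"
    by (rule sum_partial_sums_covers[OF fin q])
  finally show ?thesis .
qed

lemma pmf_segmentation_star_outside:
  assumes "\<sigma> \<in> segmentations_star \<Theta> \<mu>" "\<theta> < p"
  shows "pmf \<sigma> (\<theta>, p) = 0"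
  using assms by (auto simp: segmentations_star_def \<Omega>_def pmf_eq_0_set_pmf)

lemma sum_pmf_segmentation_star:
  assumes "\<sigma> \<in> segmentations_star \<Theta> \<mu>" "\<theta> \<in> \<Theta>"
  shows "(\<Sum>p\<in>\<Theta>. pmf \<sigma> (\<theta>, p)) = pmf \<mu> \<theta>"
  using assms by (auto simp: segmentations_star_def segmentations_def)

text \<open>Indexing by all pairs matches \<open>sum_unit_transfers\<close>; pairs with
  \<open>p \<ge> \<theta>\<^sub>0\<close> carry the zero transfer.\<close>

lemma preferred_imp_transfers:
  assumes fin: "finite \<Theta>" and card: "card \<Theta> \<ge> 2"
    and \<sigma>: "\<sigma> \<in> segmentations_star \<Theta> \<mu>" and \<sigma>': "\<sigma>' \<in> segmentations_star \<Theta> \<mu>"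
    and pref: "redistributively_preferred \<Theta> \<sigma> \<sigma>'"
  obtains t where "\<And>i. i \<in> \<Theta> \<times> \<Theta> \<Longrightarrow> t i \<in> transfers \<Theta>"
    "\<And>x. x \<in> \<Omega> \<Theta> \<Longrightarrow> pmf \<sigma> x = pmf \<sigma>' x + (\<Sum>i\<in>\<Theta> \<times> \<Theta>. t i x)"
proof -
  define d where "d x = pmf \<sigma> x - pmf \<sigma>' x" for x
  define S where "S \<theta>\<^sub>0 p = (\<Sum>x\<in>\<Theta> \<times> \<Theta>. threshold_welfare \<theta>\<^sub>0 p x * d x)" for \<theta>\<^sub>0 p
  define t where "t = (\<lambda>(\<theta>\<^sub>0, p) x. S \<theta>\<^sub>0 p * unit_transfer \<Theta> \<theta>\<^sub>0 p x)"
  show thesis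
  proof
    fix i assume "i \<in> \<Theta> \<times> \<Theta>"
    then obtain \<theta>\<^sub>0 p where i: "i = (\<theta>\<^sub>0, p)" "\<theta>\<^sub>0 \<in> \<Theta>" "p \<in> \<Theta>" by blast
    have S0: "S \<theta>\<^sub>0 p \<ge> 0"
      using pref threshold_welfare_redistributive[of \<theta>\<^sub>0 p \<Theta>]
      unfolding redistributively_preferred_def S_def d_def
      by (simp add: right_diff_distrib sum_subtractf)
    show "t i \<in> transfers \<Theta>"
    proof (cases "p < \<theta>\<^sub>0")
      case True
      then show ?thesis
        using scaled_unit_transfer_in_transfers[OF fin i(2,3) _ S0] by (simp add: i(1) t_def)
    next
      case False
      \<comment> \<open>No type lies strictly above \<open>p\<close> and at most at
        \<open>\<theta>\<^sub>0\<close>, so the weight \<open>S \<theta>\<^sub>0 p\<close>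
        vanishes.\<close>
      then have "threshold_welfare \<theta>\<^sub>0 p = (\<lambda>x. 0)"
        by (auto simp: threshold_welfare_def fun_eq_iff)
      then have "t i = (\<lambda>x. 0)"
        by (simp add: i(1) t_def S_def)
      then show ?thesis using zero_in_transfers[OF card] by simp
    qed
  next
    fix x assume "x \<in> \<Omega> \<Theta>"
    then obtain \<theta> q where x: "x = (\<theta>, q)" "\<theta> \<in> \<Theta>" "q \<in> \<Theta>" by (auto simp: \<Omega>_def)
    \<comment> \<open>Both segmentations have the type marginal \<open>\<mu>\<close>.\<close>
    have "(\<Sum>p\<in>\<Theta>. d (\<theta>, p)) = 0"
      by (simp add: d_def sum_subtractf sum_pmf_segmentation_star[OF \<sigma> x(2)]
          sum_pmf_segmentation_star[OF \<sigma>' x(2)])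
    moreover have "d (\<theta>, p) = 0" if "\<theta> < p" for p
      by (simp add: d_def pmf_segmentation_star_outside[OF \<sigma> that]
          pmf_segmentation_star_outside[OF \<sigma>' that])
    ultimately have "(\<Sum>(\<theta>\<^sub>0, p)\<in>\<Theta> \<times> \<Theta>. S \<theta>\<^sub>0 p * unit_transfer \<Theta> \<theta>\<^sub>0 p x) = d x"
      unfolding x(1) S_def by (intro sum_unit_transfers fin x(2,3))
    then show "pmf \<sigma> x = pmf \<sigma>' x + (\<Sum>i\<in>\<Theta> \<times> \<Theta>. t i x)"
      by (simp add: t_def d_def case_prod_beta)
  qed
qed

theorem proposition1:
  fixes \<Theta> :: "real set" and \<mu> :: "real pmf" and \<sigma> \<sigma>' :: "(real \<times> real) pmf"
  assumes "finite \<Theta>" and "\<Theta> \<subseteq> {0..}" and "card \<Theta> \<ge> 2"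
    and "\<mu> \<in> dists \<Theta>" and "\<forall>\<theta>\<in>\<Theta>. pmf \<mu> \<theta> > 0"
    and "\<sigma> \<in> segmentations_star \<Theta> \<mu>" and "\<sigma>' \<in> segmentations_star \<Theta> \<mu>"
  shows "redistributively_preferred \<Theta> \<sigma> \<sigma>' \<longleftrightarrow>
    (\<exists>n::nat. n > 0 \<and> (\<exists>t :: nat \<Rightarrow> real \<times> real \<Rightarrow> real.
       (\<forall>i\<in>{1..n}. t i \<in> transfers \<Theta>) \<and>
       (\<forall>x\<in>\<Omega> \<Theta>. pmf \<sigma> x = pmf \<sigma>' x + (\<Sum>i=1..n. t i x))))"
    (is "?L \<longleftrightarrow> ?R")
proof
  assume ?L
  then obtain t where t: "\<And>i. i \<in> \<Theta> \<times> \<Theta> \<Longrightarrow> t i \<in> transfers \<Theta>"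
    "\<And>x. x \<in> \<Omega> \<Theta> \<Longrightarrow> pmf \<sigma> x = pmf \<sigma>' x + (\<Sum>i\<in>\<Theta> \<times> \<Theta>. t i x)"
    using preferred_imp_transfers[OF assms(1,3,6,7)] by blast
  have fin: "finite (\<Theta> \<times> \<Theta>)" using assms by simp
  let ?n = "card (\<Theta> \<times> \<Theta>)"
  \<comment> \<open>Relabels the pairs by \<open>1..?n\<close>, because the claim lists the
    transfers by natural numbers.\<close>
  obtain h where h: "bij_betw h {1..?n} (\<Theta> \<times> \<Theta>)"
    using ex_bij_betw_nat_finite_1[OF fin] by blast
  have "?n > 0" using assms(3) by (simp add: card_cartesian_product)
  moreover have "\<forall>i\<in>{1..?n}. t (h i) \<in> transfers \<Theta>"
    using bij_betwE[OF h] t(1) by blast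
  moreover have "\<forall>x\<in>\<Omega> \<Theta>. pmf \<sigma> x = pmf \<sigma>' x + (\<Sum>i=1..?n. t (h i) x)"
    using t(2) by (auto simp: sum.reindex_bij_betw[OF h, symmetric])
  ultimately show ?R by (intro exI[of _ ?n] conjI exI[of _ "\<lambda>i. t (h i)"])
next
  assume ?R
  then obtain n and t :: "nat \<Rightarrow> real \<times> real \<Rightarrow> real"
    where "\<forall>i\<in>{1..n}. t i \<in> transfers \<Theta>"
      "\<forall>x\<in>\<Omega> \<Theta>. pmf \<sigma> x = pmf \<sigma>' x + (\<Sum>i=1..n. t i x)"
    by blast
  then show ?L
    by (intro transfers_imp_preferred[OF assms(1), of "{1..n}" t]) simp_all
qed

end
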